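(* Let $m$ be an odd positive integer, $q=2^m$, and $\gamma\in\mathbb{F}_{2^2}\setminus\mathbb{F}_2$. Let $t$ be a positive integer with $3t\equiv 1\pmod{2^m-1}$. Then the compositional inverse of the permutation polynomial $f_6(x)=x+\gamma\operatorname{Tr}_{q}^{q^2}(x+x^{q+2})$ over $\mathbb{F}_{q^2}$ is $$f_6^{-1}(x)=\operatorname{Tr}_q^{q^2}((1+\gamma)x)+\gamma\Big[\operatorname{Tr}_q^{q^2}((1+\gamma)x)+\big\{\operatorname{Tr}_q^{q^2}(x)+(\operatorname{Tr}_q^{q^2}((1+\gamma)x))^3\big\}^t\Big].$$
   Context: $\mathbb{F}_{q^2}$ is the finite field with $q^2$ elements, and $\mathbb{F}_q$, $\mathbb{F}_{2^2}$, $\mathbb{F}_2$ denote its subfields with $q$, $4$ and $2$ elements. $\operatorname{Tr}_q^{q^2}(z)=z+z^q$ for $z\in\mathbb{F}_{q^2}$. A polynomial $f\in\mathbb{F}_{q^2}[x]$ is a permutation polynomial over $\mathbb{F}_{q^2}$ if the map $a\mapsto f(a)$ is a bijection of $\mathbb{F}_{q^2}$. Its compositional inverse $f^{-1}$ is the polynomial $g$ (polynomials being identified with the maps $\mathbb{F}_{q^2}\to\mathbb{F}_{q^2}$ they induce) such that $f(g(x))=g(f(x))=x$ for every $x\in\mathbb{F}_{q^2}$. *)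

theory Defs
  imports
    "HOL-Computational_Algebra.Primes"
    "HOL-Computational_Algebra.Polynomial"
    "HOL-Number_Theory.Cong"
    "HOL-Library.Cardinality"
begin

definition is_subfield :: "'a::field set \<Rightarrow> bool" where
  "is_subfield K \<longleftrightarrow>
     0 \<in> K \<and> 1 \<in> K \<and>
     (\<forall>x\<in>K. \<forall>y\<in>K. x + y \<in> K \<and> x * y \<in> K) \<and>
     (\<forall>x\<in>K. - x \<in> K \<and> inverse x \<in> K)"

text \<open>The relative trace z + z^q from the field with q^2 elements to its subfield with q elements.
  The type is left general so that the same formula can be applied both to field elements and to
  polynomials; evaluating a polynomial commutes with it.\<close>

definition Tr :: "nat \<Rightarrow> 'a::comm_semiring_1 \<Rightarrow> 'a" where
  "Tr q z = z + z ^ q"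

definition permutation_poly :: "'a::finite_field poly \<Rightarrow> bool" where
  "permutation_poly f \<longleftrightarrow> bij (poly f)"

text \<open>Only the maps induced by the polynomials are compared, so the inverse is determined as a map
  (equivalently, modulo X^|F| - X for the finite field F), not as a formal polynomial.\<close>

definition compositional_inverse :: "'a::finite_field poly \<Rightarrow> 'a poly \<Rightarrow> bool" where
  "compositional_inverse f g \<longleftrightarrow>
     (\<forall>x. poly f (poly g x) = x \<and> poly g (poly f x) = x)"

abbreviation X :: "'a::comm_semiring_1 poly" where
  "X \<equiv> [:0, 1:]"

definition f6 :: "nat \<Rightarrow> 'a::finite_field \<Rightarrow> 'a poly" where
  "f6 q \<gamma> = X + smult \<gamma> (Tr q (X + X ^ (q + 2)))"

definition f6_inv :: "nat \<Rightarrow> nat \<Rightarrow> 'a::finite_field \<Rightarrow> 'a poly" where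
  "f6_inv q t \<gamma> =
     Tr q (smult (1 + \<gamma>) X) +
     smult \<gamma> (Tr q (smult (1 + \<gamma>) X) + (Tr q X + (Tr q (smult (1 + \<gamma>) X)) ^ 3) ^ t)"

end

theory Submission
  imports Defs
begin

text \<open>
  The field has characteristic 2, and \<open>\<gamma>\<close> is a primitive cube root of unity, so
  \<open>\<gamma>\<^sup>2 = \<gamma> + 1\<close>. For odd \<open>m\<close> it is not fixed by the Frobenius map \<open>x \<mapsto> x ^ q\<close>, but
  swapped with its conjugate \<open>\<gamma> + 1\<close>. Hence \<open>1, \<gamma>\<close> is a basis over the subfield with \<open>q\<close>
  elements, and the coordinates of \<open>x = a + \<gamma> b\<close> are traces:
  \<open>a = Tr q ((1 + \<gamma>) x)\<close> and \<open>b = Tr q x\<close>.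

  In these coordinates the polynomial is triangular. As \<open>x ^ (q + 2) = x \<cdot> x ^ (q + 1)\<close>
  and the norm \<open>x ^ (q + 1) = a\<^sup>2 + a b + b\<^sup>2\<close> lies in the subfield, the map adds
  \<open>b + b (a\<^sup>2 + a b + b\<^sup>2)\<close> to the coordinate \<open>b\<close> and leaves \<open>a\<close> alone. So \<open>(a, b)\<close> goes
  to \<open>(a, b (a\<^sup>2 + a b + b\<^sup>2))\<close>, and in characteristic 2 the new second coordinate is
  \<open>(a + b)\<^sup>3 + a\<^sup>3\<close>. Cubing is inverted on the subfield by the \<open>t\<close>-th power, which recovers
  \<open>b\<close>, and this is the stated formula. It gives a left inverse; since the field is finite,
  a left inverse is two-sided and the polynomial permutes the field.
\<close>

lemma card_2_subfield_imp_char_2: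
  fixes K :: "'a::field set"
  assumes "is_subfield K" and "card K = 2"
  shows "(1 + 1 :: 'a) = 0"
proof -
  have in_K: "0 \<in> K" "1 \<in> K" "1 + 1 \<in> K"
    using assms(1) unfolding is_subfield_def by blast+
  have "finite K" using assms(2) by (simp add: card_ge_0_finite)
  then have "{0, 1} = K"
    using in_K assms(2) by (intro card_subset_eq) auto
  then have "(1 + 1 :: 'a) = 0 \<or> 1 + 1 = (1 :: 'a)"
    using in_K(3) by (metis insert_iff empty_iff)
  then show ?thesis by (metis add_cancel_right_right zero_neq_one)
qed

lemma char_2_add_self:
  fixes x y :: "'a::comm_ring_1"
  assumes char2: "(1 + 1 :: 'a) = 0"
  shows "x + x = 0" and "x + (x + y) = y"
proof -
  show self: "x + x = 0"
    using char2 by (metis distrib_left mult.right_neutral mult_zero_right)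
  show "x + (x + y) = y" by (simp add: self flip: add.assoc)
qed

text \<open>The four elements of the subfield are \<open>0\<close>, \<open>1\<close>, \<open>\<gamma>\<close> and \<open>\<gamma> + 1\<close>. The square of \<open>\<gamma>\<close> is one
  of them, and the first three would force \<open>\<gamma>\<close> to be \<open>0\<close> or \<open>1\<close>, as \<open>-1 = 1\<close>.\<close>

lemma card_4_subfield_generator_square:
  fixes K :: "'a::field set" and \<gamma> :: 'a
  assumes char2: "(1 + 1 :: 'a) = 0"
    and K: "is_subfield K" "card K = 4"
    and \<gamma>: "\<gamma> \<in> K" "\<gamma> \<noteq> 0" "\<gamma> \<noteq> 1"
  shows "\<gamma>\<^sup>2 = \<gamma> + 1"
proof -
  have in_K: "{0, 1, \<gamma>, \<gamma> + 1} \<subseteq> K" "\<gamma>\<^sup>2 \<in> K"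
    using K(1) \<gamma>(1) by (auto simp: is_subfield_def power2_eq_square)
  have neq: "\<gamma> + 1 \<noteq> 0"
    using char2 \<gamma>(3) by (metis add_right_cancel)
  have "finite K" using K(2) by (simp add: card_ge_0_finite)
  then have "{0, 1, \<gamma>, \<gamma> + 1} = K"
    using in_K K(2) \<gamma> neq by (intro card_subset_eq) auto
  then have "\<gamma>\<^sup>2 \<in> {0, 1, \<gamma>, \<gamma> + 1}" using in_K by simp
  moreover have "\<gamma>\<^sup>2 \<noteq> 0" "\<gamma>\<^sup>2 \<noteq> \<gamma>" using \<gamma> by (auto simp: power2_eq_square)
  moreover have "\<gamma>\<^sup>2 \<noteq> 1" using \<gamma> neq by (auto simp: power2_eq_1_iff eq_neg_iff_add_eq_0)
  ultimately show ?thesis by simp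
qed

lemma power_two_power_add_char_2:
  fixes x y :: "'a::comm_ring_1"
  assumes char2: "(1 + 1 :: 'a) = 0"
  shows "(x + y) ^ (2 ^ n) = x ^ (2 ^ n) + y ^ (2 ^ n)"
proof (induction n)
  case (Suc n)
  have square: "(u + v)\<^sup>2 = u\<^sup>2 + v\<^sup>2" for u v :: 'a
    by (simp add: power2_eq_square algebra_simps char_2_add_self[OF char2])
  have power_Suc: "z ^ (2 ^ Suc n) = (z ^ (2 ^ n))\<^sup>2" for z :: 'a
    by (simp add: mult.commute flip: power_mult)
  show ?case by (simp only: power_Suc Suc square)
qed simp

text \<open>Each squaring exchanges \<open>\<gamma>\<close> and \<open>\<gamma> + 1\<close>, so an odd number of squarings does too.\<close>

lemma conjugate_of_cube_root_of_unity:
  fixes \<gamma> :: "'a::comm_ring_1"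
  assumes char2: "(1 + 1 :: 'a) = 0" and \<gamma>: "\<gamma>\<^sup>2 = \<gamma> + 1" and "odd m"
  shows "\<gamma> ^ (2 ^ m) = \<gamma> + 1"
proof -
  have "\<gamma> ^ (2 ^ n) = (if odd n then \<gamma> + 1 else \<gamma>)" for n
  proof (induction n)
    case (Suc n)
    have "(\<gamma> + 1)\<^sup>2 = \<gamma>"
      using \<gamma> by (simp add: power2_eq_square algebra_simps char_2_add_self[OF char2])
    moreover have "\<gamma> ^ (2 ^ Suc n) = (\<gamma> ^ (2 ^ n))\<^sup>2"
      by (simp add: mult.commute flip: power_mult)
    ultimately show ?case using Suc \<gamma> by simp
  qed simp
  then show ?thesis using \<open>odd m\<close> by simp
qed

text \<open>On the fixed points of \<open>w \<mapsto> w ^ q\<close>, exponents matter only modulo \<open>q - 1\<close>. With \<open>n = 3 t\<close>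
  this makes the \<open>t\<close>-th power invert cubing there; positivity of \<open>n\<close> covers \<open>w = 0\<close>.\<close>

lemma power_eq_self_if_cong_1:
  fixes w :: "'a::field"
  assumes fixed: "w ^ q = w" and "q > 0" and "n > 0" and n: "[n = 1] (mod (q - 1))"
  shows "w ^ n = w"
proof (cases "w = 0")
  case False
  have "w * w ^ (q - 1) = w * 1"
    using fixed \<open>q > 0\<close> by (simp add: power_eq_if split: if_splits)
  then have root: "w ^ (q - 1) = 1" using False by simp
  have "q - 1 dvd n - 1"
    using n \<open>n > 0\<close> by (simp add: cong_altdef_nat)
  then obtain k where "n - 1 = (q - 1) * k" by (elim dvdE)
  then have "n = Suc ((q - 1) * k)" using \<open>n > 0\<close> by simp
  then show ?thesis by (simp only: power_Suc power_mult root power_one mult_1_right)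
qed (use \<open>n > 0\<close> in simp)

lemma poly_Tr: "poly (Tr q p) x = Tr q (poly p x)"
  by (simp add: Tr_def)

text \<open>In characteristic 2, the identities for \<open>f6\<close> hold for any conjugation \<open>x \<mapsto> x ^ q\<close> that
  is an additive involution swapping \<open>\<gamma>\<close> and \<open>\<gamma> + 1\<close>.\<close>

context
  fixes q :: nat and \<gamma> :: "'a::finite_field"
  assumes char2: "(1 + 1 :: 'a) = 0"
    and \<gamma>_square: "\<gamma>\<^sup>2 = \<gamma> + 1"
    and \<gamma>_conj: "\<gamma> ^ q = \<gamma> + 1"
    and power_q_add: "\<And>x y :: 'a. (x + y) ^ q = x ^ q + y ^ q"
    and power_q_q: "\<And>x :: 'a. (x ^ q) ^ q = x"
begin

lemmas char_2_simps = algebra_simps char_2_add_self[OF char2]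

lemma Tr_power_q: "Tr q x ^ q = Tr q (x :: 'a)"
  by (simp add: Tr_def power_q_add power_q_q add.commute)

lemma Tr_add: "Tr q (x + y) = Tr q x + Tr q (y :: 'a)"
  by (simp add: Tr_def power_q_add ac_simps)

lemma Tr_mult_fixed:
  assumes "c ^ q = (c :: 'a)"
  shows "Tr q (x * c) = Tr q x * c"
  using assms by (simp add: Tr_def power_mult_distrib algebra_simps)

lemma Tr_1_plus_\<gamma>_mult: "Tr q ((1 + \<gamma>) * x) = (1 + \<gamma>) * x + \<gamma> * x ^ q"
proof -
  have "(1 + \<gamma>) ^ q = \<gamma>"
    by (simp add: power_q_add \<gamma>_conj char_2_simps)
  then show ?thesis by (simp add: Tr_def power_mult_distrib)
qed

lemma trace_coordinates: "Tr q ((1 + \<gamma>) * x) + \<gamma> * Tr q x = x"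
  unfolding Tr_1_plus_\<gamma>_mult unfolding Tr_def by (simp add: char_2_simps)

text \<open>The polynomial adds \<open>\<gamma> u\<close> with \<open>u\<close> a trace, hence fixed by conjugation. As \<open>Tr q \<gamma> = 1\<close>,
  this shifts the coordinate \<open>Tr q x\<close> by \<open>u\<close>; as \<open>(1 + \<gamma>) \<gamma> = 1\<close> has trace \<open>0\<close>, the other
  coordinate stays. The norm \<open>x ^ (q + 1)\<close> is also fixed, so it comes out of the trace in \<open>u\<close>,
  and the summand \<open>Tr q x\<close> of \<open>u\<close> cancels against the coordinate that \<open>u\<close> is added to.\<close>

lemma Tr_poly_f6:
  "Tr q (poly (f6 q \<gamma>) x) = Tr q x * x ^ (q + 1)"
  and Tr_1_plus_\<gamma>_mult_poly_f6:
  "Tr q ((1 + \<gamma>) * poly (f6 q \<gamma>) x) = Tr q ((1 + \<gamma>) * x)"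
proof -
  define u where "u = Tr q (x + x ^ (q + 2))"
  have f6: "poly (f6 q \<gamma>) x = x + \<gamma> * u"
    unfolding f6_def u_def by (simp add: poly_Tr del: power_Suc add_2_eq_Suc')
  have u_fixed: "u ^ q = u" by (simp add: u_def Tr_power_q)
  have norm_fixed: "(x ^ (q + 1)) ^ q = x ^ (q + 1)"
    by (simp add: power_mult_distrib power_q_q mult.commute)
  have "u = Tr q x + Tr q (x * x ^ (q + 1))"
    by (simp add: u_def Tr_add)
  then have u: "u = Tr q x + Tr q x * x ^ (q + 1)"
    using Tr_mult_fixed[OF norm_fixed] by simp
  have "Tr q \<gamma> = 1"
    by (simp add: Tr_def \<gamma>_conj char_2_simps)
  then have "Tr q (poly (f6 q \<gamma>) x) = Tr q x + u"
    unfolding f6 by (simp add: Tr_add Tr_mult_fixed[OF u_fixed])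
  also have "\<dots> = Tr q x * x ^ (q + 1)"
    unfolding u by (simp add: char_2_simps)
  finally show "Tr q (poly (f6 q \<gamma>) x) = Tr q x * x ^ (q + 1)" .
  show "Tr q ((1 + \<gamma>) * poly (f6 q \<gamma>) x) = Tr q ((1 + \<gamma>) * x)"
    unfolding f6 Tr_1_plus_\<gamma>_mult power_q_add power_mult_distrib u_fixed \<gamma>_conj
    by (simp add: char_2_simps)
qed

text \<open>With \<open>x = a + \<gamma> b\<close> the norm is \<open>a\<^sup>2 + a b + b\<^sup>2\<close>; multiplied by \<open>b\<close>, it completes a cube.\<close>

lemma Tr_mult_norm_eq_cube_diff:
  "Tr q x * x ^ (q + 1) + Tr q ((1 + \<gamma>) * x) ^ 3 = (Tr q ((1 + \<gamma>) * x) + Tr q x) ^ 3"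
proof -
  have \<gamma>_mult: "\<gamma> * \<gamma> = \<gamma> + 1" "\<gamma> * (\<gamma> * z) = \<gamma> * z + z" for z
    using \<gamma>_square by (simp_all add: power2_eq_square algebra_simps flip: mult.assoc)
  have norm: "x ^ (q + 1) = x * x ^ q" by simp
  show ?thesis
    unfolding norm Tr_1_plus_\<gamma>_mult unfolding Tr_def
    by (simp add: power3_eq_cube char_2_simps \<gamma>_mult)
qed

lemma f6_inv_f6:
  assumes cube_root: "\<And>w :: 'a. w ^ q = w \<Longrightarrow> (w ^ 3) ^ t = w"
  shows "poly (f6_inv q t \<gamma>) (poly (f6 q \<gamma>) x) = x"
proof -
  define a where "a = Tr q ((1 + \<gamma>) * x)"
  define b where "b = Tr q x"
  have inv: "poly (f6_inv q t \<gamma>) y =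
      Tr q ((1 + \<gamma>) * y) + \<gamma> * (Tr q ((1 + \<gamma>) * y) + (Tr q y + Tr q ((1 + \<gamma>) * y) ^ 3) ^ t)"
    for y by (simp add: f6_inv_def poly_Tr algebra_simps)
  have "(a + b) ^ q = a + b"
    by (simp add: a_def b_def power_q_add Tr_power_q)
  then have "((a + b) ^ 3) ^ t = a + b" by (rule cube_root)
  then have "poly (f6_inv q t \<gamma>) (poly (f6 q \<gamma>) x) = a + \<gamma> * (a + (a + b))"
    unfolding inv Tr_poly_f6 Tr_1_plus_\<gamma>_mult_poly_f6 Tr_mult_norm_eq_cube_diff
    by (simp only: a_def b_def)
  also have "\<dots> = a + \<gamma> * b" by (simp add: char_2_add_self[OF char2])
  also have "\<dots> = x" by (simp add: a_def b_def trace_coordinates)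
  finally show ?thesis .
qed

end

lemma left_inverse_imp_compositional_inverse:
  fixes f g :: "'a::finite_field poly"
  assumes left: "\<And>x. poly g (poly f x) = x"
  shows "permutation_poly f \<and> compositional_inverse f g"
proof -
  have "inj (poly f)" using left by (metis injI)
  then have "surj (poly f)" by (simp add: finite_UNIV_inj_surj)
  then have "poly f (poly g y) = y" for y using left by (metis surjD)
  then show ?thesis
    using left \<open>inj (poly f)\<close> \<open>surj (poly f)\<close>
    by (simp add: permutation_poly_def compositional_inverse_def bij_def)
qed

theorem theorem3p6:
  fixes m q t :: nat
    and F2 F4 :: "'a::finite_field set"
    and \<gamma> :: 'a
  assumes "odd m" and "m > 0" and "q = 2 ^ m"
    and "CARD('a) = q ^ 2"
    and "is_subfield F2" and "card F2 = 2"
    and "is_subfield F4" and "card F4 = 4"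
    and "\<gamma> \<in> F4 - F2"
    and "t > 0" and "[3 * t = 1] (mod (2 ^ m - 1))"
  shows "permutation_poly (f6 q \<gamma>) \<and> compositional_inverse (f6 q \<gamma>) (f6_inv q t \<gamma>)"
proof (rule left_inverse_imp_compositional_inverse, rule f6_inv_f6)
  show char2: "(1 + 1 :: 'a) = 0"
    using assms(5,6) by (rule card_2_subfield_imp_char_2)
  have "\<gamma> \<noteq> 0" "\<gamma> \<noteq> 1" using assms(5,9) by (auto simp: is_subfield_def)
  then show \<gamma>_square: "\<gamma>\<^sup>2 = \<gamma> + 1"
    using assms(9) by (intro card_4_subfield_generator_square[OF char2 assms(7,8)]) auto
  show "\<gamma> ^ q = \<gamma> + 1"
    unfolding \<open>q = 2 ^ m\<close> by (rule conjugate_of_cube_root_of_unity[OF char2 \<gamma>_square \<open>odd m\<close>])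
  show "(x + y) ^ q = x ^ q + y ^ q" for x y :: 'a
    unfolding \<open>q = 2 ^ m\<close> by (rule power_two_power_add_char_2[OF char2])
  show "(x ^ q) ^ q = x" for x :: 'a
    using finite_field_power_card_eq_same[of x] assms(4) by (simp add: power2_eq_square power_mult)
  show "(w ^ 3) ^ t = w" if "w ^ q = w" for w :: 'a
    using power_eq_self_if_cong_1[of w q "3 * t"] that assms(3,10,11) by (simp add: power_mult)
qed

end
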